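(* For even $n\ge 2$ and every $c\in\{0,1,\ldots,n-2\}$, we have $|\mathcal{W}_{n,c}|=N_1(n,|c|+1)/2$.
   Context: Fix an integer $n\ge 2$ and place $2n$ points equidistantly on the unit circle, labeled $1,2,\ldots,2n$ in clockwise order. $\mathcal{M}_n$ is the set of all non-crossing straight-line perfect matchings on these points. For $M\in\mathcal{M}_n$ and $e\in M$, the length $\ell(e)$ is the minimum, over the two sides of the line through $e$, of the number of other edges of $M$ lying on that side; $e$ is a perimeter edge if $\ell(e)=0$. Write the endpoints of $e$ as $i,j$ such that the circle center lies to the right of the ray from $i$ to $j$; the sign of $e$ is $\mathrm{sgn}(e)=+1$ if $i$ is odd and $-1$ if $i$ is even ($e$ is positive resp. negative). The weight of $M$ is $w(M)=\sum_{e\in M}\mathrm{sgn}(e)\,\ell(e)$. For a nonzero integer $c$ with $|c|\le n-2$, $\mathcal{W}_{n,c}$ is the set of matchings in $\mathcal{M}_n$ with weight exactly $c$; for $c=0$, $\mathcal{W}_{n,0}:=\{M_0\}$, where $M_0$ is the matching consisting only of perimeter edges, all of them positive. The generalized Narayana numbers are $N_r(n,k)=\frac{r+1}{n+1}\binom{n+1}{k}\binom{n-r-1}{k-1}$ for integers $n\ge 1$, $r\ge 0$, $1\le k\le n-r$. *)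

theory Defs
  imports "HOL-Analysis.Analysis"
begin

(* Label k sits at angle -2*pi*k/(2n), so increasing labels run clockwise. *)
definition circle_pt :: "nat \<Rightarrow> nat \<Rightarrow> complex" where
  "circle_pt n k = cis (- (2 * pi * real k / real (2 * n)))"

definition left_of_ray :: "complex \<Rightarrow> complex \<Rightarrow> complex \<Rightarrow> bool" where
  "left_of_ray p q x \<longleftrightarrow> Im (cnj (q - p) * (x - p)) > 0"

definition right_of_ray :: "complex \<Rightarrow> complex \<Rightarrow> complex \<Rightarrow> bool" where
  "right_of_ray p q x \<longleftrightarrow> Im (cnj (q - p) * (x - p)) < 0"

(* An edge is a two-element set of labels. *)
definition perfect_matching :: "nat \<Rightarrow> nat set set \<Rightarrow> bool" where
  "perfect_matching n M \<longleftrightarrow>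
     (\<forall>e\<in>M. e \<subseteq> {1..2*n} \<and> card e = 2) \<and> (\<forall>v\<in>{1..2*n}. \<exists>!e. e \<in> M \<and> v \<in> e)"

(* The convex hull of the two endpoints is the straight-line segment drawn for the edge. *)
definition edge_segment :: "nat \<Rightarrow> nat set \<Rightarrow> complex set" where
  "edge_segment n e = convex hull (circle_pt n ` e)"

definition noncrossing :: "nat \<Rightarrow> nat set set \<Rightarrow> bool" where
  "noncrossing n M \<longleftrightarrow> (\<forall>e\<in>M. \<forall>f\<in>M. e \<noteq> f \<longrightarrow> edge_segment n e \<inter> edge_segment n f = {})"

definition nc_matchings :: "nat \<Rightarrow> nat set set set" where
  "nc_matchings n = {M. perfect_matching n M \<and> noncrossing n M}"

definition edges_left :: "nat \<Rightarrow> nat set set \<Rightarrow> nat \<Rightarrow> nat \<Rightarrow> nat set set" where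
  "edges_left n M i j =
     {f \<in> M. f \<noteq> {i, j} \<and> (\<forall>k\<in>f. left_of_ray (circle_pt n i) (circle_pt n j) (circle_pt n k))}"

(* An edge e has two orientations (i, j) and (j, i); the sides to the left of these
   are the two sides of the line through e. *)
definition edge_length :: "nat \<Rightarrow> nat set set \<Rightarrow> nat set \<Rightarrow> nat" where
  "edge_length n M e = Min {card (edges_left n M i j) | i j. e = {i, j}}"

definition perimeter_edge :: "nat \<Rightarrow> nat set set \<Rightarrow> nat set \<Rightarrow> bool" where
  "perimeter_edge n M e \<longleftrightarrow> edge_length n M e = 0"

(* The circle has centre 0. The description is proper whenever e does not pass through the
   centre; an edge of a non-crossing matching can do so only if n is odd. *)
definition start_label :: "nat \<Rightarrow> nat set \<Rightarrow> nat" where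
  "start_label n e =
     (THE i. \<exists>j. e = {i, j} \<and> right_of_ray (circle_pt n i) (circle_pt n j) 0)"

definition edge_sign :: "nat \<Rightarrow> nat set \<Rightarrow> int" where
  "edge_sign n e = (if odd (start_label n e) then 1 else -1)"

definition weight :: "nat \<Rightarrow> nat set set \<Rightarrow> int" where
  "weight n M = (\<Sum>e\<in>M. edge_sign n e * int (edge_length n M e))"

(* Intended for abs c <= n - 2. For c = 0 the set is the singleton of the unique matching that
   consists only of positive perimeter edges, not the set of all matchings of weight 0. *)
definition W :: "nat \<Rightarrow> int \<Rightarrow> nat set set set" where
  "W n c =
     (if c = 0 then {M \<in> nc_matchings n. \<forall>e\<in>M. perimeter_edge n M e \<and> edge_sign n e = 1}
      else {M \<in> nc_matchings n. weight n M = c})"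

(* Meant for 1 <= k <= n - r, where the truncated subtractions are exact. *)
definition gen_narayana :: "nat \<Rightarrow> nat \<Rightarrow> nat \<Rightarrow> real" where
  "gen_narayana r n k =
     real (r + 1) / real (n + 1) * real ((n + 1) choose k) * real ((n - r - 1) choose (k - 1))"

end

theory Submission
  imports Defs "HOL-Computational_Algebra.Formal_Power_Series" "HOL-Computational_Algebra.Polynomial"
begin

text \<open>
  The regions cut out by a matching form a tree with two colour classes. Measure the length of an
  edge \<open>{i < j}\<close> on the side \<open>i<..<j\<close> and sign it by the parity of \<open>i\<close>: the sum telescopes along
  the tree to the number \<open>E\<close> of edges with even smaller label. Passing to the true weight only
  changes the edges enclosing at least \<open>n/2\<close> others, each by \<open>n - 1\<close> times its sign. These
  edges form a chain with alternating signs, hence the weight is \<open>E - (n - 1) D\<close> with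
  \<open>D \<in> {0, 1}\<close>, and the matchings in question are those with \<open>E = c\<close> and \<open>D = 0\<close>.

  Let \<open>A\<close> be the generating function of all matchings by \<open>E\<close>. Summing \<open>D\<close> over all matchings of
  \<open>n\<close> edges gives half of a convolution square of \<open>A\<close>, because \<open>n\<close> is even; the quadratic
  equation of \<open>A\<close> turns it into \<open>(A_n - (1 - y) A_(n-1)) / 2\<close>. The coefficients of \<open>A\<close> are
  the Narayana numbers, and the theorem becomes an identity between binomial coefficients.
\<close>

section \<open>Counting matchings encoded as binary trees\<close>

text \<open>A non-crossing matching of consecutive labels: \<open>Arch t u\<close> joins the first label to the one
  enclosing exactly the matching \<open>t\<close>, and is followed by \<open>u\<close>.\<close>

datatype mtree = Empty | Arch mtree mtree

lemma finite_mtrees: "finite {t::mtree. size t = n}"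
proof (induction n rule: less_induct)
  case (less n)
  have "{t::mtree. size t = n} \<subseteq>
    insert Empty ((\<lambda>(t, u). Arch t u) ` ((\<Union>m<n. {t. size t = m}) \<times> (\<Union>m<n. {t. size t = m})))"
  proof
    fix t :: mtree assume "t \<in> {t. size t = n}"
    then show "t \<in> insert Empty ((\<lambda>(t, u). Arch t u) ` ((\<Union>m<n. {t. size t = m}) \<times> (\<Union>m<n. {t. size t = m})))"
      by (cases t) auto
  qed
  moreover have "finite (\<Union>m<n. {t::mtree. size t = m})" using less by blast
  ultimately show ?case by (blast intro: finite_subset)
qed

text \<open>The number of edges whose smaller label is even, respectively odd, when the labels start at 1.
  Up to the outer region these are the regions of either colour.\<close>

fun ev od :: "mtree \<Rightarrow> nat" where
  "ev Empty = 0"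
| "ev (Arch t u) = od t + ev u"
| "od Empty = 0"
| "od (Arch t u) = Suc (ev t + od u)"

lemma ev_plus_od: "ev t + od t = size t"
  by (induction t) auto

text \<open>The signed number of edges enclosing at least \<open>h\<close> others, signed by the parity of the smaller
  label; for \<open>2 h\<close> edges in total these are the edges separating the centre from the arc
  between the last and the first label.\<close>

fun long_sign :: "nat \<Rightarrow> mtree \<Rightarrow> int" where
  "long_sign h Empty = 0"
| "long_sign h (Arch t u) = of_bool (h \<le> size t) - long_sign h t + long_sign h u"

lemma long_sign_small: "size t \<le> h \<Longrightarrow> long_sign h t = 0"
  by (induction t) auto

text \<open>An edge enclosing at least \<open>h\<close> others leaves fewer than \<open>h\<close>
  edges outside it, so the long edges are nested in a chain. The outermost lies at the top level and
  counts as 1; signs alternate inwards.\<close>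

lemma long_sign_range: "size t \<le> 2 * h \<Longrightarrow> long_sign h t \<in> {0, 1}"
proof (induction t)
  case (Arch t u)
  show ?case
  proof (cases "h \<le> size t")
    case True
    then have "long_sign h u = 0" using Arch.prems by (intro long_sign_small) auto
    then show ?thesis using Arch True by auto
  next
    case False
    then have "long_sign h t = 0" by (intro long_sign_small) auto
    then show ?thesis using Arch False by auto
  qed
qed auto

section \<open>Generating functions over trees, graded by the number of edges\<close>

definition mgf :: "(mtree \<Rightarrow> 'a::comm_ring_1) \<Rightarrow> 'a fps" where
  "mgf f = Abs_fps (\<lambda>n. \<Sum>t | size t = n. f t)"

lemma mgf_cmult: "mgf (\<lambda>t. c * f t) = fps_const c * mgf f"
  by (simp add: mgf_def fps_eq_iff sum_distrib_left)

text \<open>Pairs of trees graded by total size: splitting \<open>Arch t u\<close> leads here, and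
  weights that factor become products of series.\<close>

definition mgf2 :: "(mtree \<Rightarrow> mtree \<Rightarrow> 'a::comm_ring_1) \<Rightarrow> 'a fps" where
  "mgf2 f = Abs_fps (\<lambda>n. \<Sum>m=0..n. \<Sum>t | size t = m. \<Sum>u | size u = n - m. f t u)"

lemma mgf2_add: "mgf2 (\<lambda>t u. f t u + g t u) = mgf2 f + mgf2 g"
  and mgf2_diff: "mgf2 (\<lambda>t u. f t u - g t u) = mgf2 f - mgf2 g"
  by (simp_all add: mgf2_def fps_eq_iff sum.distrib sum_subtractf)

lemma mgf2_mult: "mgf2 (\<lambda>t u. f t * g u) = mgf f * mgf g"
  by (simp add: mgf2_def mgf_def fps_eq_iff fps_mult_nth sum_product)

lemma mgf_rec: "mgf f = fps_const (f Empty) + fps_X * mgf2 (\<lambda>t u. f (Arch t u))"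
proof (rule fps_ext)
  fix n
  show "fps_nth (mgf f) n = fps_nth (fps_const (f Empty) + fps_X * mgf2 (\<lambda>t u. f (Arch t u))) n"
  proof (cases n)
    case 0
    have "size t = 0 \<longleftrightarrow> t = Empty" for t :: mtree by (cases t) auto
    with 0 show ?thesis by (simp add: mgf_def)
  next
    case (Suc k)
    let ?S = "SIGMA m:{0..k}. {t::mtree. size t = m} \<times> {u::mtree. size u = k - m}"
    have im: "{t::mtree. size t = n} = (\<lambda>(m, t, u). Arch t u) ` ?S"
    proof (intro set_eqI iffI)
      fix t :: mtree assume "t \<in> {t. size t = n}"
      with Suc obtain a b where "t = Arch a b" "size a + size b = k" by (cases t) auto
      then show "t \<in> (\<lambda>(m, t, u). Arch t u) ` ?S"
        by (intro image_eqI[of _ _ "(size a, a, b)"]) auto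
    qed (use Suc in auto)
    have inj: "inj_on (\<lambda>(m, t, u). Arch t u) ?S" by (auto simp: inj_on_def)
    have "fps_nth (mgf f) n = sum f {t. size t = n}" by (simp add: mgf_def)
    also have "\<dots> = (\<Sum>(m, t, u)\<in>?S. f (Arch t u))"
      by (rule sum.reindex_cong[OF inj im]) auto
    also have "\<dots> = (\<Sum>m=0..k. \<Sum>t | size t = m. \<Sum>u | size u = k - m. f (Arch t u))"
      unfolding sum.cartesian_product by (subst sum.Sigma) (simp_all add: finite_mtrees)
    finally show ?thesis using Suc by (simp add: mgf2_def)
  qed
qed

definition yv :: "int poly" where "yv = monom 1 1"

definition "evgf = mgf (\<lambda>t. yv ^ ev t)"
definition "odgf = mgf (\<lambda>t. yv ^ od t)"
definition "evgf_ge h = mgf (\<lambda>t. of_bool (h \<le> size t) * yv ^ ev t)"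

lemma evgf_rec: "evgf = 1 + fps_X * odgf * evgf"
  unfolding evgf_def odgf_def
  by (subst mgf_rec) (simp add: power_add mgf2_mult)

lemma odgf_rec: "odgf = 1 + fps_X * fps_const yv * evgf * odgf"
  unfolding evgf_def odgf_def
  by (subst (1) mgf_rec) (simp add: power_add mgf2_mult mgf_cmult flip: mult.assoc)

text \<open>Both recurrences contain the same product of series, one of them with an extra factor y.
  Hence on nonempty trees of fixed size \<open>od\<close> is distributed like
  \<open>ev + 1\<close>.\<close>

lemma odgf_eq: "odgf = 1 + fps_const yv * (evgf - 1)"
  using evgf_rec odgf_rec by (metis (no_types, lifting) add_diff_cancel_left' mult.assoc mult.commute)

lemma coeff_odgf_pos: "n \<noteq> 0 \<Longrightarrow> fps_nth odgf n = yv * fps_nth evgf n"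
  by (subst odgf_eq) simp

lemma evgf_quadratic:
  "fps_X * fps_const yv * evgf * evgf = evgf - 1 - fps_X * fps_const (1 - yv) * evgf"
proof -
  have "evgf = 1 + fps_X * (1 + fps_const yv * (evgf - 1)) * evgf"
    using evgf_rec odgf_eq by simp
  then show ?thesis
    by (simp add: algebra_simps flip: fps_const_sub)
qed

text \<open>The right-hand side is the contribution of the first edge alone; those of the two
  subtrees cancel in total.\<close>

lemma long_sign_gf:
  assumes "h \<noteq> 0"
  shows "mgf (\<lambda>t. of_int (long_sign h t) * yv ^ ev t) = fps_X * fps_const yv * evgf_ge h * evgf"
proof -
  define d where "d = mgf (\<lambda>t. of_int (long_sign h t) * yv ^ ev t)"
  define dO where "dO = mgf (\<lambda>t. of_int (long_sign h t) * yv ^ od t)"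
  define H where "H = evgf_ge h"
  \<comment> \<open>On nonempty trees \<open>od\<close> costs one factor y more than
    \<open>ev\<close>; \<open>h \<noteq> 0\<close> excludes the empty tree, where this
    fails.\<close>
  have ge_od: "mgf (\<lambda>t. of_bool (h \<le> size t) * yv ^ od t) = fps_const yv * H"
  proof (rule fps_ext)
    fix n
    have "fps_nth (mgf (\<lambda>t. of_bool (h \<le> size t) * yv ^ od t)) n = of_bool (h \<le> n) * fps_nth odgf n"
      by (simp add: mgf_def odgf_def)
    also have "\<dots> = of_bool (h \<le> n) * (yv * fps_nth evgf n)"
      using assms by (cases "h \<le> n") (auto simp: coeff_odgf_pos)
    also have "\<dots> = fps_nth (fps_const yv * H) n"
      by (simp add: H_def evgf_ge_def mgf_def evgf_def)
    finally show "fps_nth (mgf (\<lambda>t. of_bool (h \<le> size t) * yv ^ od t)) n = fps_nth (fps_const yv * H) n" .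
  qed
  have d: "d = fps_X * (fps_const yv * H * evgf - dO * evgf + odgf * d)"
  proof -
    have "d = fps_X * mgf2 (\<lambda>t u. (of_bool (h \<le> size t) * yv ^ od t) * yv ^ ev u
        - (of_int (long_sign h t) * yv ^ od t) * yv ^ ev u
        + yv ^ od t * (of_int (long_sign h u) * yv ^ ev u))"
      unfolding d_def by (subst mgf_rec) (simp add: power_add algebra_simps)
    then show ?thesis
      by (simp only: mgf2_add mgf2_diff mgf2_mult ge_od flip: d_def dO_def evgf_def odgf_def)
  qed
  have dO: "dO = fps_X * fps_const yv * (H * odgf - d * odgf + evgf * dO)"
  proof -
    have "dO = fps_X * mgf2 (\<lambda>t u. (yv * (of_bool (h \<le> size t) * yv ^ ev t)) * yv ^ od u
        - (yv * (of_int (long_sign h t) * yv ^ ev t)) * yv ^ od u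
        + (yv * yv ^ ev t) * (of_int (long_sign h u) * yv ^ od u))"
      unfolding dO_def by (subst mgf_rec) (simp add: power_add algebra_simps)
    also have "\<dots> = fps_X * (fps_const yv * H * odgf - fps_const yv * d * odgf + fps_const yv * evgf * dO)"
      by (simp only: mgf2_add mgf2_diff mgf2_mult mgf_cmult H_def flip: d_def dO_def evgf_def odgf_def evgf_ge_def)
    finally show ?thesis by (simp add: algebra_simps)
  qed
  \<comment> \<open>Subtract a guessed solution of the linear system for \<open>d\<close> and
    \<open>dO\<close>. The guesses are proportional to \<open>evgf\<close> and \<open>odgf\<close>,
    so their cross terms cancel and the errors satisfy the homogeneous system.\<close>
  define e where "e = d - fps_X * fps_const yv * H * evgf"
  define eO where "eO = dO - fps_X * fps_const yv * H * odgf"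
  have e: "e = fps_X * (odgf * e - evgf * eO)"
    unfolding e_def eO_def by (subst d) (simp add: algebra_simps)
  have eO: "eO = fps_X * fps_const yv * (evgf * eO - odgf * e)"
    unfolding e_def eO_def by (subst dO) (simp add: algebra_simps)
  have "eO = - (fps_const yv * (fps_X * (odgf * e - evgf * eO)))"
    by (subst eO) (simp add: algebra_simps)
  then have eO_e: "eO = - (fps_const yv * e)" using e by simp
  \<comment> \<open>After eliminating \<open>eO\<close>, a series with constant term 1 annihilates
    \<open>e\<close>, and there are no zero divisors.\<close>
  have "e * (1 - fps_X * (odgf + fps_const yv * evgf)) = 0"
    using e unfolding eO_e by (simp add: algebra_simps)
  moreover have "fps_nth (1 - fps_X * (odgf + fps_const yv * evgf)) 0 = 1" by simp
  then have "1 - fps_X * (odgf + fps_const yv * evgf) \<noteq> 0" by (metis fps_zero_nth zero_neq_one)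
  ultimately have "e = 0" by simp
  then show ?thesis by (simp add: e_def d_def H_def)
qed

text \<open>In degree \<open>2 * h - 1\<close> the product \<open>evgf_ge h * evgf\<close> has half
  the coefficient of \<open>evgf * evgf\<close>, as the convolution has no middle term. The
  quadratic equation evaluates the square.\<close>

lemma long_sign_gf_double:
  assumes "n = 2 * h" "h \<noteq> 0"
  shows "2 * (\<Sum>t | size t = n. of_int (long_sign h t) * yv ^ ev t)
    = fps_nth evgf n - (1 - yv) * fps_nth evgf (n - 1)"
proof -
  let ?a = "fps_nth evgf"
  define N where "N = n - 1"
  have N: "n = Suc N" using assms by (simp add: N_def)
  have split: "{0..N} = {0..<h} \<union> {h..N}" "{0..<h} \<inter> {h..N} = {}"
    using assms N by auto
  have mirror: "(\<Sum>i=0..<h. ?a i * ?a (N - i)) = (\<Sum>i=h..N. ?a i * ?a (N - i))"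
    by (rule sum.reindex_bij_witness[where i="\<lambda>i. N - i" and j="\<lambda>i. N - i"]) (use assms N in auto)
  have H: "fps_nth (evgf_ge h) i = of_bool (h \<le> i) * ?a i" for i
    by (simp add: evgf_ge_def evgf_def mgf_def)
  have "fps_nth (evgf_ge h * evgf) N = (\<Sum>i=0..N. of_bool (h \<le> i) * (?a i * ?a (N - i)))"
    by (simp add: fps_mult_nth H mult.assoc)
  also have "\<dots> = (\<Sum>i=h..N. ?a i * ?a (N - i))"
    unfolding split(1) by (subst sum.union_disjoint) (use split in auto)
  finally have half: "fps_nth (evgf_ge h * evgf) N = (\<Sum>i=h..N. ?a i * ?a (N - i))" .
  have "fps_nth (evgf * evgf) N = 2 * (\<Sum>i=h..N. ?a i * ?a (N - i))"
    unfolding fps_mult_nth split(1) by (subst sum.union_disjoint) (use split mirror in auto)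
  then have sq: "fps_nth (evgf * evgf) N = 2 * fps_nth (evgf_ge h * evgf) N" using half by simp
  have "(\<Sum>t | size t = n. of_int (long_sign h t) * yv ^ ev t)
      = fps_nth (mgf (\<lambda>t. of_int (long_sign h t) * yv ^ ev t)) n"
    by (simp add: mgf_def)
  also have "\<dots> = yv * fps_nth (evgf_ge h * evgf) N"
    unfolding long_sign_gf[OF assms(2)] N by (simp add: mult.assoc)
  finally have "2 * (\<Sum>t | size t = n. of_int (long_sign h t) * yv ^ ev t) = yv * fps_nth (evgf * evgf) N"
    unfolding sq by simp
  also have "\<dots> = fps_nth (fps_X * fps_const yv * evgf * evgf) n"
    unfolding N by (simp add: mult.assoc)
  also have "\<dots> = ?a n - (1 - yv) * ?a N"
    unfolding evgf_quadratic unfolding N by (simp add: mult.assoc del: fps_const_sub)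
  finally show ?thesis by (simp add: N_def)
qed

section \<open>Narayana numbers as coefficients of the matching series\<close>

text \<open>The coefficients of the powers of the series \<open>w = z (1 + w) (1 + y w)\<close>. Lagrange inversion
  gives \<open>k / (r + 1)\<close> times \<open>r + 1 choose c\<close> times \<open>r + 1 choose c + k\<close>; in this determinantal
  form the recurrence becomes an instance of Pascal's rule. The case distinctions guard the
  truncated subtractions.\<close>

definition narayana_det :: "nat \<Rightarrow> nat \<Rightarrow> nat \<Rightarrow> int" where
  "narayana_det r k c = int (r choose c) * int (if c + k = 0 then 0 else r choose (c + k - 1))
     - (if c = 0 then 0 else int (r choose (c - 1)) * int (r choose (c + k)))"

lemma narayana_det_0: "narayana_det r 0 c = 0"
  by (simp add: narayana_det_def)

text \<open>Mirrors the four terms of w^(k+1) = z w^k (1 + w) (1 + y w); the two terms carrying y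
  shift \<open>c\<close> to \<open>c - 1\<close>.\<close>

lemma narayana_det_Suc:
  "narayana_det (Suc r) (Suc k) c = narayana_det r k c + narayana_det r (Suc k) c
     + (if c = 0 then 0 else narayana_det r (Suc k) (c - 1) + narayana_det r (Suc (Suc k)) (c - 1))"
proof (cases c)
  case 0
  then show ?thesis by (cases k) (simp_all add: narayana_det_def)
next
  case (Suc b)
  then show ?thesis
    by (cases b; cases k) (simp_all add: narayana_det_def algebra_simps)
qed

lemma coeff_yv_mult: "coeff (yv * p) c = (if c = 0 then 0 else coeff p (c - 1))"
  by (simp add: yv_def coeff_monom_mult)

text \<open>The nonempty part of \<open>evgf\<close>: without a constant term, it satisfies an
  equation of Lagrange type.\<close>

definition "wgf = fps_X * odgf * evgf"

lemma wgf_eq: "wgf = fps_X * (1 + wgf) * (1 + fps_const yv * wgf)"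
proof -
  have a: "evgf = 1 + wgf" using evgf_rec by (simp add: wgf_def)
  have b: "odgf = 1 + fps_const yv * wgf" by (subst odgf_eq) (simp add: a)
  have "wgf = fps_X * odgf * evgf" by (simp add: wgf_def)
  then show ?thesis unfolding a b by (simp add: algebra_simps)
qed

lemma wgf_power_nth_Suc:
  "fps_nth (wgf ^ Suc k) (Suc n) = fps_nth (wgf ^ k) n + fps_nth (wgf ^ Suc k) n
     + yv * fps_nth (wgf ^ Suc k) n + yv * fps_nth (wgf ^ Suc (Suc k)) n"
proof -
  have "wgf ^ Suc k = wgf ^ k * wgf" by simp
  also have "\<dots> = wgf ^ k * (fps_X * (1 + wgf) * (1 + fps_const yv * wgf))"
    using wgf_eq by simp
  also have "\<dots> = fps_X * (wgf ^ k + wgf ^ Suc k + fps_const yv * wgf ^ Suc k + fps_const yv * wgf ^ Suc (Suc k))"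
    by (simp add: algebra_simps)
  finally have "fps_nth (wgf ^ Suc k) (Suc n) = fps_nth (fps_X * (wgf ^ k + wgf ^ Suc k + fps_const yv * wgf ^ Suc k + fps_const yv * wgf ^ Suc (Suc k))) (Suc n)"
    by simp
  then show ?thesis by (simp del: power_Suc)
qed

text \<open>The recurrence for one power involves the next, so the induction on the degree covers
  all powers at once. Degrees \<open>Suc r\<close> avoid the constant term of
  \<open>wgf ^ 0\<close>.\<close>

lemma coeff_wgf_power: "coeff (fps_nth (wgf ^ k) (Suc r)) c = narayana_det r k c"
proof (induction r arbitrary: k c)
  case 0
  have z: "fps_nth (wgf ^ j) 0 = of_bool (j = 0)" for j
    by (simp add: fps_nth_power_0 wgf_def power_0_left mult.assoc)
  show ?case
  proof (cases k)
    case (Suc j)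
    show ?thesis unfolding Suc wgf_power_nth_Suc z
      by (auto simp: narayana_det_def coeff_1 gr0_conv_Suc)
  qed (simp add: narayana_det_0)
next
  case (Suc r)
  show ?case
  proof (cases k)
    case 0 then show ?thesis by (simp add: narayana_det_0)
  next
    case (Suc j)
    show ?thesis unfolding \<open>k = Suc j\<close> narayana_det_Suc
      by (subst wgf_power_nth_Suc) (simp only: coeff_add coeff_yv_mult Suc.IH, simp)
  qed
qed

lemma coeff_evgf: "coeff (fps_nth evgf (Suc r)) c = narayana_det r 1 c"
proof -
  have a: "evgf = 1 + wgf" using evgf_rec by (simp add: wgf_def)
  show ?thesis using coeff_wgf_power[of 1 r c] by (simp add: a)
qed

text \<open>Absorption turns \<open>Suc r\<close> times each entry, a binomial coefficient of row
  \<open>r\<close>, into a multiple of one in row \<open>Suc r\<close>; the determinant of the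
  multipliers is \<open>Suc r\<close>.\<close>

lemma real_narayana_det:
  "real_of_int (narayana_det r 1 c) = real (Suc r choose c) * real (Suc r choose Suc c) / real (Suc r)"
proof -
  define N where "N = real (Suc r)"
  define C where "C k = real (Suc r choose k)" for k
  define P where "P = (if c = 0 then 0 else real (r choose (c - 1)))"
  have f1: "N * real (r choose c) = (real c + 1) * C (Suc c)"
  proof -
    have "real (Suc r) * real (r choose c) = real (Suc r choose Suc c) * real (Suc c)"
      using Suc_times_binomial_eq[of r c] by (metis of_nat_mult)
    then show ?thesis by (simp only: N_def C_def mult.commute of_nat_Suc add.commute)
  qed
  have f2: "N * P = real c * C c"
  proof (cases c)
    case (Suc b)
    have "real (Suc r) * real (r choose b) = real (Suc r choose Suc b) * real (Suc b)"
      using Suc_times_binomial_eq[of r b] by (metis of_nat_mult)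
    with Suc show ?thesis by (simp only: N_def C_def P_def mult.commute diff_Suc_1 nat.distinct if_False)
  qed (simp add: P_def)
  have f3: "C c = real (r choose c) + P"
    by (cases c) (simp_all add: C_def P_def)
  have f4: "C (Suc c) = real (r choose Suc c) + real (r choose c)"
    by (simp add: C_def)
  have N: "N > 0" by (simp add: N_def)
  have "real_of_int (narayana_det r 1 c) = real (r choose c) * real (r choose c) - P * real (r choose Suc c)"
    by (simp add: narayana_det_def P_def)
  then have "N * N * real_of_int (narayana_det r 1 c) = N * (C c * C (Suc c))"
  proof -
    have g1: "N * real (r choose c) = (N - real c) * C c"
      using f2 f3 by (simp add: algebra_simps)
    have g2: "N * real (r choose Suc c) = (N - real c - 1) * C (Suc c)"
      using f1 f4 by (simp add: algebra_simps)
    assume "real_of_int (narayana_det r 1 c) = real (r choose c) * real (r choose c) - P * real (r choose Suc c)"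
    then have "N * N * real_of_int (narayana_det r 1 c)
        = (N * real (r choose c)) * (N * real (r choose c)) - (N * P) * (N * real (r choose Suc c))"
      by (simp only:) (simp add: algebra_simps)
    also have "\<dots> = ((N - real c) * C c) * ((real c + 1) * C (Suc c)) - (real c * C c) * ((N - real c - 1) * C (Suc c))"
      by (metis f1 f2 g1 g2)
    finally show ?thesis by (simp add: algebra_simps)
  qed
  then have "N * real_of_int (narayana_det r 1 c) = C c * C (Suc c)" using N by simp
  then show ?thesis using N by (simp add: N_def C_def field_simps)
qed

text \<open>The left side is a coefficient of A_n + (1 - y) A_(n-1) for \<open>n = p + 2\<close>.
  Every binomial coefficient is a rational multiple of \<open>p choose c\<close>; writing
  \<open>p = c + q\<close> avoids truncated subtraction.\<close>

lemma narayana_identity: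
  assumes "c \<le> p"
  shows "real_of_int (narayana_det (Suc p) 1 c + narayana_det p 1 c - (if c = 0 then 0 else narayana_det p 1 (c - 1)))
    = gen_narayana 1 (p + 2) (c + 1)"
proof -
  obtain q where p: "p = c + q" using assms le_Suc_ex by blast
  define x where "x = real (p choose c)"
  have up: "real (Suc m choose c) = real (m choose c) * (real m + 1) / (real m + 1 - real c)" if "c \<le> m" for m
  proof -
    have "real (Suc m - c) * real (Suc m choose c) = real (Suc m) * real (m choose c)"
      using binomial_absorb_comp[of "Suc m" c] by (metis diff_Suc_1 of_nat_mult)
    then show ?thesis using that by (simp add: field_simps of_nat_diff)
  qed
  have diag: "real (Suc m choose Suc k) = real (m choose k) * (real m + 1) / (real k + 1)" for m k
  proof -
    have "real (Suc m) * real (m choose k) = real (Suc m choose Suc k) * real (Suc k)"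
      using Suc_times_binomial_eq[of m k] by (metis of_nat_mult)
    then show ?thesis by (simp add: field_simps)
  qed
  have c1: "real (Suc p choose c) = x * (real c + real q + 1) / (real q + 1)"
    using up[of p] by (simp add: x_def p)
  have c2: "real (Suc (Suc p) choose c) = x * (real c + real q + 1) / (real q + 1) * (real c + real q + 2) / (real q + 2)"
    using up[of "Suc p"] unfolding c1 by (simp add: p add.commute add.left_commute)
  have c3: "real (Suc p choose Suc c) = x * (real c + real q + 1) / (real c + 1)"
    using diag[of p c] by (simp add: x_def p)
  have c4: "real (Suc (Suc p) choose Suc c) = x * (real c + real q + 1) / (real q + 1) * (real c + real q + 2) / (real c + 1)"
    using diag[of "Suc p" c] unfolding c1 by (simp add: p)
  have c5: "real (Suc (Suc (Suc p)) choose Suc c)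
      = x * (real c + real q + 1) / (real q + 1) * (real c + real q + 2) / (real q + 2) * (real c + real q + 3) / (real c + 1)"
    using diag[of "Suc (Suc p)" c] unfolding c2 by (simp add: p)
  \<comment> \<open>The factor \<open>real c\<close> absorbs the case \<open>c = 0\<close>.\<close>
  have c6: "real_of_int (if c = 0 then 0 else narayana_det p 1 (c - 1))
      = real c * x / ((real q + 1) * (real q + 2)) * x * (real c + real q + 1) / (real q + 1)"
  proof (cases c)
    case (Suc b)
    define Y Z where "Y = real (Suc (Suc p) choose c)" and "Z = real (Suc p choose b)"
    have "Y = Z * (real p + 2) / real c"
      using diag[of "Suc p" b] by (simp only: Y_def Z_def Suc of_nat_Suc) (simp add: add.commute)
    then have "Z = Y * real c / (real p + 2)"
      using Suc by (simp add: field_simps)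
    also have "\<dots> = x * (real c + real q + 1) / (real q + 1) * real c / (real q + 2)"
      unfolding Y_def c2 by (simp add: p)
    finally have Z: "Z = x * (real c + real q + 1) / (real q + 1) * real c / (real q + 2)" .
    have "real_of_int (narayana_det p 1 b) = Z * real (Suc p choose c) / (real c + real q + 1)"
      unfolding real_narayana_det Z_def Suc by (simp add: p Suc)
    also have "\<dots> = real c * x / ((real q + 1) * (real q + 2)) * x * (real c + real q + 1) / (real q + 1)"
      unfolding Z c1 by (simp add: divide_simps)
    finally show ?thesis by (simp add: Suc)
  qed simp
  have L: "real_of_int (narayana_det (Suc p) 1 c + narayana_det p 1 c - (if c = 0 then 0 else narayana_det p 1 (c - 1)))
     = real (Suc (Suc p) choose c) * real (Suc (Suc p) choose Suc c) / (real c + real q + 2)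
     + real (Suc p choose c) * real (Suc p choose Suc c) / (real c + real q + 1)
     - real c * x / ((real q + 1) * (real q + 2)) * x * (real c + real q + 1) / (real q + 1)"
    unfolding of_int_add of_int_diff c6 real_narayana_det by (simp add: p add.commute add.left_commute)
  have R: "gen_narayana 1 (p + 2) (c + 1) = 2 / (real c + real q + 3) * real (Suc (Suc (Suc p)) choose Suc c) * x"
    by (simp add: gen_narayana_def x_def p)
  define a b where "a = real c" and "b = real q"
  define S T where "S = a + b + 1" and "T = a + b + 2"
  \<comment> \<open>\<open>K\<close> is common to all four terms; a quadratic identity between
    \<open>S\<close>, \<open>T\<close>, \<open>a\<close> and \<open>b\<close> remains.\<close>
  define K where "K = x * x * S / ((b + 1) * (b + 1) * (b + 2) * (a + 1))"
  have pos: "a + b + 3 \<noteq> 0" "T \<noteq> 0" "S \<noteq> 0" "a + 1 \<noteq> 0" "b + 1 \<noteq> 0" "b + 2 \<noteq> 0"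
    by (simp_all add: a_def b_def S_def T_def add_nonneg_eq_0_iff)
  have t1: "x * S / (b + 1) * T / (b + 2) * (x * S / (b + 1) * T / (a + 1)) / T = K * (S * T)"
    using pos by (simp add: K_def divide_simps)
  have t2: "x * S / (b + 1) * (x * S / (a + 1)) / S = K * ((b + 1) * (b + 2))"
    using pos by (simp add: K_def divide_simps)
  have t3: "a * x / ((b + 1) * (b + 2)) * x * S / (b + 1) = K * (a * (a + 1))"
    using pos by (simp add: K_def divide_simps)
  have t4: "2 / (a + b + 3) * (x * S / (b + 1) * T / (b + 2) * (a + b + 3) / (a + 1)) * x = K * (2 * T * (b + 1))"
    using pos by (simp add: K_def divide_simps)
  have "S * T + (b + 1) * (b + 2) - a * (a + 1) = 2 * T * (b + 1)"
    by (simp add: S_def T_def algebra_simps)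
  then have "K * (S * T) + K * ((b + 1) * (b + 2)) - K * (a * (a + 1)) = K * (2 * T * (b + 1))"
    by (metis distrib_left right_diff_distrib)
  then show ?thesis
    unfolding L R c1 c2 c3 c4 c5 a_def[symmetric] b_def[symmetric]
      S_def[symmetric] T_def[symmetric] t1 t2 t3 t4 .
qed

text \<open>As \<open>long_sign\<close> is 0 or 1 here, its weighted sum counts the trees of value
  1. Removing these from all trees with \<open>ev t = c\<close> leaves half a coefficient of A_n +
  (1 - y) A_(n-1).\<close>

lemma card_mtrees_ev_short:
  assumes "n = 2 * h" "h \<noteq> 0" "c \<le> n - 2"
  shows "real (card {t. size t = n \<and> ev t = c \<and> long_sign h t = 0}) = gen_narayana 1 n (c + 1) / 2"
proof -
  define p where "p = n - 2"
  have n: "n = Suc (Suc p)" using assms by (auto simp: p_def)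
  let ?T = "{t::mtree. size t = n}"
  have cf: "coeff (yv ^ k) c = of_bool (k = c)" for k
    by (simp add: yv_def monom_power)
  have fin: "finite ?T" by (rule finite_mtrees)
  have range: "long_sign h t \<noteq> 0 \<longleftrightarrow> long_sign h t = 1" if "t \<in> ?T" for t
    using long_sign_range[of t h] that assms(1) by auto
  have all: "int (card {t \<in> ?T. ev t = c}) = coeff (fps_nth evgf n) c"
    using fin by (simp add: evgf_def mgf_def coeff_sum cf of_bool_def flip: sum.inter_filter)
  have "coeff (\<Sum>t\<in>?T. of_int (long_sign h t) * yv ^ ev t) c = (\<Sum>t\<in>?T. long_sign h t * of_bool (ev t = c))"
    by (simp add: coeff_sum cf of_int_poly)
  also have "\<dots> = (\<Sum>t\<in>?T. of_bool (ev t = c \<and> long_sign h t = 1))"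
  proof (rule sum.cong[OF refl])
    fix t assume "t \<in> ?T"
    from range[OF this] show "long_sign h t * of_bool (ev t = c) = of_bool (ev t = c \<and> long_sign h t = 1)"
      by auto
  qed
  also have "\<dots> = int (card {t \<in> ?T. ev t = c \<and> long_sign h t = 1})"
    using fin by (simp add: of_bool_def flip: sum.inter_filter)
  finally have one: "coeff (\<Sum>t\<in>?T. of_int (long_sign h t) * yv ^ ev t) c = int (card {t \<in> ?T. ev t = c \<and> long_sign h t = 1})" .
  have "{t \<in> ?T. ev t = c} = {t \<in> ?T. ev t = c \<and> long_sign h t = 0} \<union> {t \<in> ?T. ev t = c \<and> long_sign h t = 1}"
  proof (rule set_eqI)
    fix t
    show "t \<in> {t \<in> ?T. ev t = c} \<longleftrightarrow>
        t \<in> {t \<in> ?T. ev t = c \<and> long_sign h t = 0} \<union> {t \<in> ?T. ev t = c \<and> long_sign h t = 1}"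
      using range[of t] by auto
  qed
  then have "card {t \<in> ?T. ev t = c} = card {t \<in> ?T. ev t = c \<and> long_sign h t = 0} + card {t \<in> ?T. ev t = c \<and> long_sign h t = 1}"
    by (simp only:) (subst card_Un_disjoint, use fin in auto)
  moreover have dbl: "coeff (2 * q) c = 2 * coeff q c" for q :: "int poly"
    by (simp only: mult_2 coeff_add)
  ultimately have "2 * int (card {t \<in> ?T. ev t = c \<and> long_sign h t = 0})
     = 2 * coeff (fps_nth evgf n) c - coeff (2 * (\<Sum>t\<in>?T. of_int (long_sign h t) * yv ^ ev t)) c"
    unfolding dbl one all[symmetric] by linarith
  also have "\<dots> = coeff (fps_nth evgf n) c + coeff (fps_nth evgf (n - 1)) c - coeff (yv * fps_nth evgf (n - 1)) c"
    unfolding long_sign_gf_double[OF assms(1,2)] by (simp add: left_diff_distrib)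
  also have "\<dots> = narayana_det (Suc p) 1 c + narayana_det p 1 c - (if c = 0 then 0 else narayana_det p 1 (c - 1))"
    by (simp add: n coeff_yv_mult coeff_evgf)
  finally have "real_of_int (2 * int (card {t \<in> ?T. ev t = c \<and> long_sign h t = 0})) = gen_narayana 1 (p + 2) (c + 1)"
    using narayana_identity[of c p] assms(3) n by (simp only: diff_Suc_Suc numeral_2_eq_2 diff_zero)
  then show ?thesis using n by simp
qed

section \<open>Chords of the regular polygon\<close>

text \<open>Twice the signed area of a triangle, positive if it is traversed
  counterclockwise.\<close>

definition orient :: "complex \<Rightarrow> complex \<Rightarrow> complex \<Rightarrow> real" where
  "orient p q x = Im (cnj (q - p) * (x - p))"

text \<open>Angles are doubled so that the area factors into sines of half the central
  angles.\<close>

lemma orient_cis: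
  "orient (cis (- (2 * a))) (cis (- (2 * b))) (cis (- (2 * c))) = 4 * sin (a - b) * sin (b - c) * sin (a - c)"
proof -
  have *: "orient (cis (- (2 * a))) (cis (- (2 * b))) (cis (- (2 * c)))
     = sin (2 * a - 2 * b) + sin (2 * b - 2 * c) - sin (2 * a - 2 * c)"
    by (simp add: orient_def sin_diff algebra_simps)
  define u v where "u = a - b" and "v = b - c"
  have "orient (cis (- (2 * a))) (cis (- (2 * b))) (cis (- (2 * c))) = sin (2 * u) + sin (2 * v) - sin (2 * (u + v))"
    unfolding * u_def v_def by (simp add: algebra_simps)
  also have "\<dots> = 4 * sin u * sin v * sin (u + v)"
  proof -
    have "sin (2 * u) = 2 * sin u * cos u" "sin (2 * v) = 2 * sin v * cos v"
      "sin (2 * (u + v)) = 2 * sin (u + v) * cos (u + v)" by (simp_all only: sin_double)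
    moreover have "(cos u)^2 = 1 - (sin u)^2" "(cos v)^2 = 1 - (sin v)^2"
      by (simp_all add: cos_squared_eq)
    ultimately show ?thesis unfolding sin_add cos_add by algebra
  qed
  finally show ?thesis by (simp add: u_def v_def algebra_simps)
qed

lemma orient_circle_pt:
  assumes "n > 0"
  shows "orient (circle_pt n i) (circle_pt n j) (circle_pt n k)
    = 4 * sin (pi * (real i - real j) / (2 * n)) * sin (pi * (real j - real k) / (2 * n)) * sin (pi * (real i - real k) / (2 * n))"
proof -
  have c: "circle_pt n m = cis (- (2 * (pi * real m / (2 * n))))" for m
    by (simp add: circle_pt_def)
  show ?thesis unfolding c orient_cis
    by (simp add: right_diff_distrib diff_divide_distrib)
qed

text \<open>Labels differ by less than \<open>2 * n\<close>, so the argument lies strictly between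
  -pi and pi.\<close>

lemma sin_sign:
  assumes "n > 0" "i \<in> {1..2*n}" "j \<in> {1..2*n}"
  shows "sgn (sin (pi * (real i - real j) / (2 * n))) = sgn (real i - real j)"
proof -
  have pos: "sin (pi * (real i - real j) / (2 * n)) > 0" if "j < i" "i \<in> {1..2*n}" "j \<in> {1..2*n}" for i j
  proof (rule sin_gt_zero)
    show "0 < pi * (real i - real j) / (2 * n)" using that assms by simp
    have "real i - real j < real (2 * n)" using that by auto
    then have "pi * (real i - real j) < pi * real (2 * n)" by simp
    then show "pi * (real i - real j) / (2 * n) < pi" using assms by (simp add: field_simps)
  qed
  consider "i < j" | "i = j" | "j < i" by linarith
  then show ?thesis
  proof cases
    case 1
    have "sin (pi * (real i - real j) / (2 * n)) = - sin (pi * (real j - real i) / (2 * n))"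
      unfolding sin_minus[symmetric] by (simp add: minus_divide_left algebra_simps)
    with pos[of i j] 1 assms show ?thesis by simp
  qed (use pos[of j i] assms in auto)
qed

lemma sgn_orient:
  assumes "i \<in> {1..2*n}" "j \<in> {1..2*n}" "k \<in> {1..2*n}"
  shows "sgn (orient (circle_pt n i) (circle_pt n j) (circle_pt n k))
    = sgn (real i - real j) * sgn (real j - real k) * sgn (real i - real k)"
proof -
  have n: "n > 0" using assms by auto
  show ?thesis unfolding orient_circle_pt[OF n] sgn_mult using sin_sign[OF n] assms by simp
qed

text \<open>The labels \<open>i\<close>, \<open>k\<close>, \<open>j\<close> follow each other
  clockwise; for \<open>i < j\<close> the points left of the ray are those labelled strictly
  between.\<close>

lemma orient_pos_iff:
  assumes "i \<in> {1..2*n}" "j \<in> {1..2*n}" "k \<in> {1..2*n}"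
  shows "orient (circle_pt n i) (circle_pt n j) (circle_pt n k) > 0
    \<longleftrightarrow> i < k \<and> k < j \<or> k < j \<and> j < i \<or> j < i \<and> i < k"
proof -
  have "orient (circle_pt n i) (circle_pt n j) (circle_pt n k) > 0
    \<longleftrightarrow> sgn (real i - real j) * sgn (real j - real k) * sgn (real i - real k) > 0"
    unfolding sgn_orient[OF assms, symmetric] by simp
  also have "\<dots> \<longleftrightarrow> i < k \<and> k < j \<or> k < j \<and> j < i \<or> j < i \<and> i < k"
    by (auto simp: sgn_if)
  finally show ?thesis .
qed

lemma orient_neg_iff:
  assumes "i \<in> {1..2*n}" "j \<in> {1..2*n}" "k \<in> {1..2*n}"
  shows "orient (circle_pt n i) (circle_pt n j) (circle_pt n k) < 0
    \<longleftrightarrow> i < j \<and> j < k \<or> j < k \<and> k < i \<or> k < i \<and> i < j"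
proof -
  have "orient (circle_pt n i) (circle_pt n j) (circle_pt n k) < 0
    \<longleftrightarrow> sgn (real i - real j) * sgn (real j - real k) * sgn (real i - real k) < 0"
    unfolding sgn_orient[OF assms, symmetric] by simp
  also have "\<dots> \<longleftrightarrow> i < j \<and> j < k \<or> j < k \<and> k < i \<or> k < i \<and> i < j"
    by (auto simp: sgn_if)
  finally show ?thesis .
qed

section \<open>Crossing and disjoint chords\<close>

lemma orient_affine:
  assumes "u + v = 1"
  shows "orient p q (u *\<^sub>R x + v *\<^sub>R y) = u * orient p q x + v * orient p q y"
proof -
  have u: "u = 1 - v" using assms by simp
  show ?thesis unfolding u orient_def by (simp add: algebra_simps)
qed

text \<open>Cramer's rule for four points of the plane; by \<open>orient_dependence_sum\<close> the
  coefficients add up to 0.\<close>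

lemma orient_affine_dependence:
  "orient b c d *\<^sub>R a - orient a c d *\<^sub>R b + orient a b d *\<^sub>R c - orient a b c *\<^sub>R d = 0"
  by (simp add: complex_eq_iff orient_def algebra_simps)

lemma orient_dependence_sum: "orient b c d - orient a c d + orient a b d - orient a b c = 0"
  by (simp add: orient_def algebra_simps)

lemma in_segment_hull:
  "0 \<le> u \<Longrightarrow> 0 \<le> v \<Longrightarrow> u + v = 1 \<Longrightarrow> u *\<^sub>R x + v *\<^sub>R y \<in> convex hull {x, y}"
  by (auto simp: convex_hull_2)

text \<open>Interleaving gives the affine dependence of the four points positive coefficients on one
  chord and negative ones on the other; normalised, it exhibits a common point.\<close>

lemma crossing_segments_meet:
  assumes "a \<in> {1..2*n}" "b \<in> {1..2*n}" "c \<in> {1..2*n}" "d \<in> {1..2*n}" "a < c" "c < b" "b < d"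
  shows "edge_segment n {a, b} \<inter> edge_segment n {c, d} \<noteq> {}"
proof -
  let ?p = "circle_pt n"
  define A B C D where "A = orient (?p b) (?p c) (?p d)" and "B = - orient (?p a) (?p c) (?p d)"
    and "C = - orient (?p a) (?p b) (?p d)" and "D = orient (?p a) (?p b) (?p c)"
  have pos: "A > 0" "B > 0" "C > 0" "D > 0"
    unfolding A_def B_def C_def D_def neg_0_less_iff_less
    using assms by (simp_all add: orient_pos_iff orient_neg_iff)
  have sum: "A + B = C + D"
    using orient_dependence_sum[of "?p b" "?p c" "?p d" "?p a"] by (simp add: A_def B_def C_def D_def)
  have "A *\<^sub>R ?p a + B *\<^sub>R ?p b = C *\<^sub>R ?p c + D *\<^sub>R ?p d"
    using orient_affine_dependence[of "?p b" "?p c" "?p d" "?p a"]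
    by (simp add: A_def B_def C_def D_def algebra_simps)
  then have "inverse (A + B) *\<^sub>R (A *\<^sub>R ?p a + B *\<^sub>R ?p b) = inverse (C + D) *\<^sub>R (C *\<^sub>R ?p c + D *\<^sub>R ?p d)"
    using sum by simp
  then have eq: "(A / (A + B)) *\<^sub>R ?p a + (B / (A + B)) *\<^sub>R ?p b = (C / (C + D)) *\<^sub>R ?p c + (D / (C + D)) *\<^sub>R ?p d"
    by (simp add: scaleR_add_right divide_inverse mult.commute)
  have "(A / (A + B)) *\<^sub>R ?p a + (B / (A + B)) *\<^sub>R ?p b \<in> edge_segment n {a, b}"
    using pos by (simp add: edge_segment_def in_segment_hull flip: add_divide_distrib)
  moreover have "(C / (C + D)) *\<^sub>R ?p c + (D / (C + D)) *\<^sub>R ?p d \<in> edge_segment n {c, d}"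
    using pos by (simp add: edge_segment_def in_segment_hull flip: add_divide_distrib)
  ultimately show ?thesis using eq by auto
qed

text \<open>Without interleaving, \<open>c\<close> and \<open>d\<close> lie strictly on one side of
  the line through \<open>a\<close> and \<open>b\<close>, hence so does their whole chord.\<close>

lemma segments_disjoint:
  assumes "a \<in> {1..2*n}" "b \<in> {1..2*n}" "c \<in> {1..2*n}" "d \<in> {1..2*n}"
    and "a < b" "c < d" "{a, b} \<inter> {c, d} = {}" "\<not> (a < c \<and> c < b \<and> b < d)" "\<not> (c < a \<and> a < d \<and> d < b)"
  shows "edge_segment n {a, b} \<inter> edge_segment n {c, d} = {}"
proof (rule ccontr)
  assume "edge_segment n {a, b} \<inter> edge_segment n {c, d} \<noteq> {}"
  then obtain x where x: "x \<in> edge_segment n {a, b}" "x \<in> edge_segment n {c, d}" by auto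
  let ?o = "orient (circle_pt n a) (circle_pt n b)"
  have zero: "?o (circle_pt n a) = 0" "?o (circle_pt n b) = 0" by (simp_all add: orient_def algebra_simps)
  have ox: "?o x = 0"
    using x(1) zero by (auto simp: edge_segment_def convex_hull_2 orient_affine)
  obtain u v where uv: "u \<ge> 0" "v \<ge> 0" "u + v = 1" "x = u *\<^sub>R circle_pt n c + v *\<^sub>R circle_pt n d"
    using x(2) by (auto simp: edge_segment_def convex_hull_2)
  have "?o (circle_pt n c) > 0 \<and> ?o (circle_pt n d) > 0 \<or> ?o (circle_pt n c) < 0 \<and> ?o (circle_pt n d) < 0"
    unfolding orient_pos_iff[OF assms(1,2,3)] orient_pos_iff[OF assms(1,2,4)]
      orient_neg_iff[OF assms(1,2,3)] orient_neg_iff[OF assms(1,2,4)]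
    using assms(5-) by auto
  moreover have "u * ?o (circle_pt n c) + v * ?o (circle_pt n d) = 0"
    using ox uv(3,4) by (simp add: orient_affine)
  ultimately show False using uv(1-3)
    by (smt (verit) mult_nonneg_nonneg mult_pos_pos mult_nonneg_nonpos mult_pos_neg)
qed

text \<open>The area spanned with the centre is up to sign the sine of
  \<open>pi * (j - i) / n\<close>, which changes sign at pi.\<close>

lemma right_of_ray_centre_iff:
  assumes "n > 0" "i \<in> {1..2*n}" "j \<in> {1..2*n}" "i < j"
  shows "right_of_ray (circle_pt n i) (circle_pt n j) 0 \<longleftrightarrow> j - i < n"
    and "right_of_ray (circle_pt n j) (circle_pt n i) 0 \<longleftrightarrow> n < j - i"
proof -
  define x where "x = pi * real (j - i) / n"
  have eq: "Im (cnj (circle_pt n j - circle_pt n i) * (0 - circle_pt n i)) = - sin x"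
    "Im (cnj (circle_pt n i - circle_pt n j) * (0 - circle_pt n j)) = sin x"
  proof -
    have "x = 2 * pi * real j / real (2 * n) - 2 * pi * real i / real (2 * n)"
      using assms by (simp add: x_def field_simps of_nat_diff)
    then show "Im (cnj (circle_pt n j - circle_pt n i) * (0 - circle_pt n i)) = - sin x"
      "Im (cnj (circle_pt n i - circle_pt n j) * (0 - circle_pt n j)) = sin x"
      by (simp_all only: circle_pt_def sin_diff) (simp_all add: algebra_simps)
  qed
  have "real (j - i) < real (2 * n)" using assms by auto
  then have "pi * real (j - i) < pi * real (2 * n)" by simp
  then have x: "0 < x" "x < 2 * pi" using assms by (auto simp: x_def field_simps of_nat_diff)
  obtain m where m: "j - i = m" by blast
  have lt: "x < pi \<longleftrightarrow> j - i < n" and gt: "pi < x \<longleftrightarrow> n < j - i"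
    unfolding x_def m using assms(1) by (simp_all add: divide_less_eq less_divide_eq)
  have s: "sin x > 0 \<longleftrightarrow> x < pi" "sin x < 0 \<longleftrightarrow> x > pi"
    using x sin_gt_zero[of x] sin_lt_zero[of x] sin_pi by (smt (verit))+
  show "right_of_ray (circle_pt n i) (circle_pt n j) 0 \<longleftrightarrow> j - i < n"
    "right_of_ray (circle_pt n j) (circle_pt n i) 0 \<longleftrightarrow> n < j - i"
    unfolding right_of_ray_def eq using s lt gt by auto
qed

lemma left_of_ray_orient: "left_of_ray p q x \<longleftrightarrow> orient p q x > 0"
  by (simp add: left_of_ray_def orient_def)

section \<open>Non-crossing matchings as trees\<close>

text \<open>General label sets are allowed so that the parts inside and outside an edge are again
  such matchings. Crossing becomes interleaving of endpoints.\<close>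

definition ncm_on :: "nat set \<Rightarrow> nat set set \<Rightarrow> bool" where
  "ncm_on V M \<longleftrightarrow> (\<forall>e\<in>M. \<exists>i\<in>V. \<exists>j\<in>V. i < j \<and> e = {i, j}) \<and> (\<forall>v\<in>V. \<exists>!e. e \<in> M \<and> v \<in> e)
     \<and> (\<forall>a b c d. {a, b} \<in> M \<longrightarrow> {c, d} \<in> M \<longrightarrow> \<not> (a < c \<and> c < b \<and> b < d))"

lemma ncm_on_edge_ex: "ncm_on V M \<Longrightarrow> e \<in> M \<Longrightarrow> \<exists>i\<in>V. \<exists>j\<in>V. i < j \<and> e = {i, j}"
  by (simp add: ncm_on_def)

lemma ncm_on_edgeE:
  assumes "ncm_on V M" "e \<in> M"
  obtains i j where "i \<in> V" "j \<in> V" "i < j" "e = {i, j}"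
  using ncm_on_edge_ex[OF assms] by blast

lemma ncm_on_edge_subset:
  assumes "ncm_on V M" "e \<in> M"
  shows "e \<subseteq> V"
  using ncm_on_edge_ex[OF assms] by auto

lemma ncm_on_edgeD:
  assumes "ncm_on V M" "{a, b} \<in> M"
  shows "a \<in> V" "b \<in> V" "a \<noteq> b"
  using ncm_on_edge_ex[OF assms] by (auto simp: doubleton_eq_iff)

lemma ncm_on_unique:
  assumes "ncm_on V M" "e \<in> M" "f \<in> M" "v \<in> e" "v \<in> f"
  shows "e = f"
proof -
  have "v \<in> V" using ncm_on_edge_subset[OF assms(1,2)] assms(4) by auto
  then have "\<exists>!e. e \<in> M \<and> v \<in> e" using assms(1) by (simp add: ncm_on_def)
  then show ?thesis using assms(2-) by blast
qed

lemma ncm_on_noncrossing: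
  "ncm_on V M \<Longrightarrow> {a, b} \<in> M \<Longrightarrow> {c, d} \<in> M \<Longrightarrow> a < c \<Longrightarrow> c < b \<Longrightarrow> b < d \<Longrightarrow> False"
  by (auto simp: ncm_on_def)

lemma ncm_on_restrict:
  assumes "ncm_on V M" "U \<subseteq> V" "\<And>f. f \<in> M \<Longrightarrow> f \<inter> U \<noteq> {} \<Longrightarrow> f \<subseteq> U"
  shows "ncm_on U {f \<in> M. f \<subseteq> U}"
  unfolding ncm_on_def
proof (intro conjI ballI allI impI)
  fix e assume "e \<in> {f \<in> M. f \<subseteq> U}"
  then have "e \<subseteq> U" "\<exists>i\<in>V. \<exists>j\<in>V. i < j \<and> e = {i, j}" using ncm_on_edge_ex[OF assms(1)] by auto
  then show "\<exists>i\<in>U. \<exists>j\<in>U. i < j \<and> e = {i, j}" by auto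
next
  fix v assume v: "v \<in> U"
  then obtain e where e: "e \<in> M" "v \<in> e" using assms(1,2) unfolding ncm_on_def by blast
  show "\<exists>!e. e \<in> {f \<in> M. f \<subseteq> U} \<and> v \<in> e"
  proof (rule ex1I[of _ e])
    show "e \<in> {f \<in> M. f \<subseteq> U} \<and> v \<in> e" using e v assms(3) by auto
  qed (use e ncm_on_unique[OF assms(1)] in auto)
next
  fix a b c d assume "{a, b} \<in> {f \<in> M. f \<subseteq> U}" "{c, d} \<in> {f \<in> M. f \<subseteq> U}"
  then show "\<not> (a < c \<and> c < b \<and> b < d)" using ncm_on_noncrossing[OF assms(1)] by auto
qed

lemma ncm_on_card:
  assumes "ncm_on V M" "finite V"
  shows "2 * card M = card V"
proof -
  have sub: "\<Union>M \<subseteq> V" using ncm_on_edge_subset[OF assms(1)] by blast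
  moreover have "V \<subseteq> \<Union>M" using assms(1) unfolding ncm_on_def by blast
  ultimately have U: "\<Union>M = V" by blast
  have "M \<subseteq> Pow V" using sub by blast
  then have fin: "finite M" using assms(2) finite_subset by blast
  have "2 * card M = card (\<Union>M)"
  proof (rule card_partition)
    show "card e = 2" if "e \<in> M" for e
      using ncm_on_edge_ex[OF assms(1) that] by auto
    show "e \<inter> f = {}" if "e \<in> M" "f \<in> M" "e \<noteq> f" for e f
      using ncm_on_unique[OF assms(1) that(1,2)] that(3) by blast
  qed (use fin U assms(2) in auto)
  then show ?thesis by (simp add: U)
qed

text \<open>Trades segments for labels: \<open>crossing_segments_meet\<close> gives one direction,
  \<open>segments_disjoint\<close> the other.\<close>

lemma nc_matchings_iff: "M \<in> nc_matchings n \<longleftrightarrow> ncm_on {1..2*n} M"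
proof -
  have pm: "perfect_matching n M \<longleftrightarrow> (\<forall>e\<in>M. \<exists>i\<in>{1..2*n}. \<exists>j\<in>{1..2*n}. i < j \<and> e = {i, j})
      \<and> (\<forall>v\<in>{1..2*n}. \<exists>!e. e \<in> M \<and> v \<in> e)"
  proof -
    have "e \<subseteq> {1..2*n} \<and> card e = 2 \<longleftrightarrow> (\<exists>i\<in>{1..2*n}. \<exists>j\<in>{1..2*n}. i < j \<and> e = {i, j})" for e :: "nat set"
    proof
      assume e: "e \<subseteq> {1..2*n} \<and> card e = 2"
      then obtain x y where xy: "e = {x, y}" "x \<noteq> y" by (auto simp: card_2_iff)
      show "\<exists>i\<in>{1..2*n}. \<exists>j\<in>{1..2*n}. i < j \<and> e = {i, j}"
      proof (cases "x < y")
        case True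
        then show ?thesis using e xy by (intro bexI[of _ x] bexI[of _ y]) auto
      next
        case False
        then have "y < x" "e = {y, x}" using xy by auto
        then show ?thesis using e by (intro bexI[of _ y] bexI[of _ x]) auto
      qed
    qed auto
    then show ?thesis by (simp only: perfect_matching_def)
  qed
  show ?thesis
  proof
    assume M: "M \<in> nc_matchings n"
    then have p: "perfect_matching n M" and nc: "noncrossing n M" by (auto simp: nc_matchings_def)
    have "\<not> (a < c \<and> c < b \<and> b < d)" if "{a, b} \<in> M" "{c, d} \<in> M" for a b c d
    proof
      assume lt: "a < c \<and> c < b \<and> b < d"
      have "{a, b} \<subseteq> {1..2*n}" "{c, d} \<subseteq> {1..2*n}" using p that by (simp_all only: perfect_matching_def)
      then have "edge_segment n {a, b} \<inter> edge_segment n {c, d} \<noteq> {}"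
        using crossing_segments_meet[of a n b c d] lt by auto
      moreover have "{a, b} \<noteq> {c, d}" using lt by (auto simp: doubleton_eq_iff)
      ultimately show False using nc[unfolded noncrossing_def, rule_format, OF that] by blast
    qed
    then show "ncm_on {1..2*n} M" using p by (simp only: pm ncm_on_def) simp
  next
    assume M: "ncm_on {1..2*n} M"
    then have p: "perfect_matching n M" by (simp only: pm ncm_on_def, elim conjE, intro conjI)
    have "edge_segment n e \<inter> edge_segment n f = {}" if ef: "e \<in> M" "f \<in> M" "e \<noteq> f" for e f
    proof -
      obtain a b where ab: "a \<in> {1..2*n}" "b \<in> {1..2*n}" "a < b" "e = {a, b}" using ncm_on_edgeE[OF M ef(1)] .
      obtain c d where cd: "c \<in> {1..2*n}" "d \<in> {1..2*n}" "c < d" "f = {c, d}" using ncm_on_edgeE[OF M ef(2)] .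
      have "{a, b} \<inter> {c, d} = {}" using ncm_on_unique[OF M ef(1,2)] ef(3) ab(4) cd(4) by blast
      moreover have "\<not> (a < c \<and> c < b \<and> b < d)" "\<not> (c < a \<and> a < d \<and> d < b)"
        using ncm_on_noncrossing[OF M, of a b c d] ncm_on_noncrossing[OF M, of c d a b] ef(1,2)
        unfolding ab(4) cd(4) by auto
      ultimately show ?thesis unfolding ab(4) cd(4)
        by (rule segments_disjoint[OF ab(1,2) cd(1,2) ab(3) cd(3)])
    qed
    then show "M \<in> nc_matchings n" using p by (simp add: nc_matchings_def noncrossing_def)
  qed
qed

lemma ncm_on_inside_outside:
  assumes "ncm_on V M" "{i, j} \<in> M" "i < j" "f \<in> M" "f \<noteq> {i, j}"
  shows "f \<subseteq> {i<..<j} \<or> f \<subseteq> V - {i..j}"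
proof -
  obtain a b where ab: "a \<in> V" "b \<in> V" "a < b" "f = {a, b}" using ncm_on_edgeE[OF assms(1,4)] .
  have "{i, j} \<inter> {a, b} = {}" using ncm_on_unique[OF assms(1,2,4)] assms(5) ab(4) by blast
  moreover have "\<not> (i < a \<and> a < j \<and> j < b)" "\<not> (a < i \<and> i < b \<and> b < j)"
    using ncm_on_noncrossing[OF assms(1), of i j a b] ncm_on_noncrossing[OF assms(1), of a b i j]
      assms(2,4) unfolding ab(4) by auto
  ultimately show ?thesis using ab assms(3) by (auto simp: not_less)
qed

lemma ncm_on_inside:
  assumes "ncm_on V M" "{i, j} \<in> M" "i < j" "{i<..<j} \<subseteq> V"
  shows "ncm_on {i<..<j} {f \<in> M. f \<subseteq> {i<..<j}}"
proof (rule ncm_on_restrict[OF assms(1,4)])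
  fix f assume f: "f \<in> M" "f \<inter> {i<..<j} \<noteq> {}"
  then have "f \<noteq> {i, j}" by auto
  from ncm_on_inside_outside[OF assms(1-3) f(1) this] f(2) show "f \<subseteq> {i<..<j}" by force
qed

lemma ncm_on_outside:
  assumes "ncm_on V M" "{i, j} \<in> M" "i < j"
  shows "ncm_on (V - {i..j}) {f \<in> M. f \<subseteq> V - {i..j}}"
proof (rule ncm_on_restrict[OF assms(1)])
  fix f assume f: "f \<in> M" "f \<inter> (V - {i..j}) \<noteq> {}"
  then have "f \<noteq> {i, j}" using assms(3) by auto
  from ncm_on_inside_outside[OF assms f(1) this] f(2) show "f \<subseteq> V - {i..j}" by force
qed auto

section \<open>Edge sets of trees and the bijection with matchings\<close>

fun edges :: "nat \<Rightarrow> mtree \<Rightarrow> nat set set" where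
  "edges s Empty = {}"
| "edges s (Arch t u) = insert {s, s + 2 * size t + 1} (edges (s + 1) t \<union> edges (s + 2 * size t + 2) u)"

text \<open>\<open>M\<close> lives below the arch from \<open>s\<close> to \<open>j\<close> and
  \<open>N\<close> beyond it, so crossing edges would both lie in \<open>M\<close> or both in
  \<open>N\<close>.\<close>

lemma ncm_on_join:
  assumes M: "ncm_on {s + 1..<j} M" and N: "ncm_on {j + 1..<k} N" and "s < j" "j < k"
  shows "ncm_on {s..<k} (insert {s, j} (M \<union> N))"
proof -
  have mM: "s < x \<and> x < j" if "e \<in> M" "x \<in> e" for e x
    using ncm_on_edge_subset[OF M that(1)] that(2) by auto
  have mN: "j < x \<and> x < k" if "e \<in> N" "x \<in> e" for e x
    using ncm_on_edge_subset[OF N that(1)] that(2) by auto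
  show ?thesis unfolding ncm_on_def
  proof (intro conjI ballI allI impI)
    fix e assume e: "e \<in> insert {s, j} (M \<union> N)"
    then consider "e = {s, j}" | "e \<in> M" | "e \<in> N" by blast
    then show "\<exists>i\<in>{s..<k}. \<exists>j\<in>{s..<k}. i < j \<and> e = {i, j}"
    proof cases
      case 1
      then show ?thesis using assms(3,4) by (intro bexI[of _ s] bexI[of _ j]) auto
    next
      case 2
      obtain i l where "i \<in> {s+1..<j}" "l \<in> {s+1..<j}" "i < l" "e = {i, l}" using ncm_on_edgeE[OF M 2] .
      then show ?thesis using assms(3,4) by (intro bexI[of _ i] bexI[of _ l]) auto
    next
      case 3
      obtain i l where "i \<in> {j+1..<k}" "l \<in> {j+1..<k}" "i < l" "e = {i, l}" using ncm_on_edgeE[OF N 3] .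
      then show ?thesis using assms(3,4) by (intro bexI[of _ i] bexI[of _ l]) auto
    qed
  next
    fix v assume v: "v \<in> {s..<k}"
    then consider "v = s \<or> v = j" | "v \<in> {s+1..<j}" | "v \<in> {j+1..<k}" by (auto simp: not_less Suc_le_eq) linarith
    then show "\<exists>!e. e \<in> insert {s, j} (M \<union> N) \<and> v \<in> e"
    proof cases
      case 1
      show ?thesis
      proof (rule ex1I[of _ "{s, j}"])
        fix f assume "f \<in> insert {s, j} (M \<union> N) \<and> v \<in> f"
        then show "f = {s, j}" using 1 mM[of f v] mN[of f v] assms(3) by auto
      qed (use 1 in auto)
    next
      case 2
      then obtain e where e: "e \<in> M" "v \<in> e" using M unfolding ncm_on_def by blast
      show ?thesis
      proof (rule ex1I[of _ e])
        fix f assume f: "f \<in> insert {s, j} (M \<union> N) \<and> v \<in> f"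
        then have "f \<in> M" using 2 mN[of f v] by auto
        then show "f = e" using ncm_on_unique[OF M] e f by blast
      qed (use e in auto)
    next
      case 3
      then obtain e where e: "e \<in> N" "v \<in> e" using N unfolding ncm_on_def by blast
      show ?thesis
      proof (rule ex1I[of _ e])
        fix f assume f: "f \<in> insert {s, j} (M \<union> N) \<and> v \<in> f"
        then have "f \<in> N" using 3 mM[of f v] assms(3) by auto
        then show "f = e" using ncm_on_unique[OF N] e f by blast
      qed (use e in auto)
    qed
  next
    fix a b c d assume ab: "{a, b} \<in> insert {s, j} (M \<union> N)" and cd: "{c, d} \<in> insert {s, j} (M \<union> N)"
    have 1: "a = s \<and> b = j \<or> a = j \<and> b = s \<or> {a, b} \<in> M \<and> a \<in> {s<..<j} \<and> b \<in> {s<..<j} \<or> {a, b} \<in> N \<and> a > j \<and> b > j"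
      using ab mM[of "{a, b}" a] mM[of "{a, b}" b] mN[of "{a, b}" a] mN[of "{a, b}" b]
      by (auto simp: doubleton_eq_iff)
    have 2: "c = s \<and> d = j \<or> c = j \<and> d = s \<or> {c, d} \<in> M \<and> c \<in> {s<..<j} \<and> d \<in> {s<..<j} \<or> {c, d} \<in> N \<and> c > j \<and> d > j"
      using cd mM[of "{c, d}" c] mM[of "{c, d}" d] mN[of "{c, d}" c] mN[of "{c, d}" d]
      by (auto simp: doubleton_eq_iff)
    show "\<not> (a < c \<and> c < b \<and> b < d)"
      using 1 2 assms(3) ncm_on_noncrossing[OF M, of a b c d] ncm_on_noncrossing[OF N, of a b c d] by auto
  qed
qed

lemma ncm_on_edges: "ncm_on {s..<s + 2 * size t} (edges s t)"
proof (induction t arbitrary: s)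
  case Empty
  then show ?case by (simp add: ncm_on_def)
next
  case (Arch t u)
  have "ncm_on {s..<s + 2 * size (Arch t u)}
     (insert {s, s + 2 * size t + 1} (edges (s + 1) t \<union> edges (s + 2 * size t + 2) u))"
    by (rule ncm_on_join) (use Arch.IH(1)[of "s + 1"] Arch.IH(2)[of "s + 2 * size t + 2"] in \<open>auto simp: algebra_simps\<close>)
  then show ?case by simp
qed

text \<open>Cut along the edge from \<open>s\<close> to its partner \<open>j\<close>. The labels
  between are matched among themselves, hence even in number, which gives the offset
  \<open>2 * m + 1\<close>.\<close>

lemma ncm_on_imp_edges:
  "ncm_on {s..<s + 2 * n} M \<Longrightarrow> \<exists>t. size t = n \<and> M = edges s t"
proof (induction n arbitrary: s M rule: less_induct)
  case (less n)
  note M = less.prems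
  show ?case
  proof (cases "n = 0")
    case True
    then have "M = {}" using ncm_on_edge_ex[OF M] by fastforce
    then show ?thesis using True by (intro exI[of _ Empty]) simp
  next
    case False
    then have "s \<in> {s..<s + 2 * n}" by simp
    then obtain e where e: "e \<in> M" "s \<in> e" using M unfolding ncm_on_def by blast
    obtain i j' where ij: "i \<in> {s..<s + 2 * n}" "j' \<in> {s..<s + 2 * n}" "i < j'" "e = {i, j'}"
      using ncm_on_edgeE[OF M e(1)] .
    obtain j where j: "s < j" "j < s + 2 * n" "{s, j} \<in> M"
      using ij e by (intro that[of j']) auto
    have sub: "{s<..<j} \<subseteq> {s..<s + 2 * n}" using j by auto
    define M1 where "M1 = {f \<in> M. f \<subseteq> {s<..<j}}"
    define M2 where "M2 = {f \<in> M. f \<subseteq> {s..<s + 2 * n} - {s..j}}"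
    have M1: "ncm_on {s<..<j} M1" unfolding M1_def by (rule ncm_on_inside[OF M j(3,1) sub])
    have M2: "ncm_on ({s..<s + 2 * n} - {s..j}) M2" unfolding M2_def by (rule ncm_on_outside[OF M j(3,1)])
    have eq: "M = insert {s, j} (M1 \<union> M2)"
      using ncm_on_inside_outside[OF M j(3,1)] j(3) by (auto simp: M1_def M2_def)
    define m where "m = card M1"
    have m: "2 * m = j - s - 1" using ncm_on_card[OF M1] by (simp add: m_def)
    then have j_eq: "j = s + 2 * m + 1" using j(1) by simp
    have mn: "m < n" using j j_eq by simp
    have i1: "{s<..<j} = {s + 1..<(s + 1) + 2 * m}" unfolding j_eq by auto
    have i2: "{s..<s + 2 * n} - {s..j} = {s + 2 * m + 2..<(s + 2 * m + 2) + 2 * (n - 1 - m)}"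
      unfolding j_eq using mn by auto
    obtain t where t: "size t = m" "M1 = edges (s + 1) t" using less.IH[OF mn M1[unfolded i1]] by blast
    obtain u where u: "size u = n - 1 - m" "M2 = edges (s + 2 * m + 2) u"
      using less.IH[OF _ M2[unfolded i2]] mn by auto
    show ?thesis by (rule exI[of _ "Arch t u"]) (use t u mn eq j_eq in auto)
  qed
qed

lemma edges_range:
  assumes "e \<in> edges s t"
  shows "e \<subseteq> {s..<s + 2 * size t}" "e \<noteq> {}"
  using ncm_on_edge_ex[OF ncm_on_edges assms] by auto

text \<open>Label ranges recover the subtrees, for the injectivity of \<open>edges\<close>;
  disjointness serves the summations.\<close>

lemma
  shows edges_inside: "{f \<in> edges s (Arch t u). f \<subseteq> {s + 1..s + 2 * size t}} = edges (s + 1) t"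
    and edges_after: "{f \<in> edges s (Arch t u). f \<subseteq> {s + 2 * size t + 2..}} = edges (s + 2 * size t + 2) u"
    and edges_disjoint: "edges (s + 1) t \<inter> edges (s + 2 * size t + 2) u = {}"
proof -
  let ?A = "{s + 1..s + 2 * size t}" and ?B = "{s + 2 * size t + 2..}"
  \<comment> \<open>Nonemptiness matters: the empty set would lie in both label ranges.\<close>
  have 1: "f \<subseteq> ?A \<and> f \<noteq> {}" if "f \<in> edges (s + 1) t" for f
    using edges_range[OF that] by auto
  have 2: "f \<subseteq> ?B \<and> f \<noteq> {}" if "f \<in> edges (s + 2 * size t + 2) u" for f
    using edges_range[OF that] by auto
  have 3: "\<not> {s, s + 2 * size t + 1} \<subseteq> ?A" "\<not> {s, s + 2 * size t + 1} \<subseteq> ?B" by auto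
  have "?A \<inter> ?B = {}" by auto
  then have 4: "\<not> (f \<subseteq> ?A \<and> f \<subseteq> ?B \<and> f \<noteq> {})" for f by blast
  show "edges (s + 1) t \<inter> edges (s + 2 * size t + 2) u = {}"
    using 1 2 4 by (meson disjoint_iff)
  have mem: "f \<in> edges s (Arch t u) \<longleftrightarrow>
      f = {s, s + 2 * size t + 1} \<or> f \<in> edges (s + 1) t \<or> f \<in> edges (s + 2 * size t + 2) u" for f
    by simp
  show "{f \<in> edges s (Arch t u). f \<subseteq> ?A} = edges (s + 1) t"
  proof (rule set_eqI)
    fix f
    show "f \<in> {f \<in> edges s (Arch t u). f \<subseteq> ?A} \<longleftrightarrow> f \<in> edges (s + 1) t"
      unfolding mem_Collect_eq mem using 1[of f] 2[of f] 3 4[of f] by metis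
  qed
  show "{f \<in> edges s (Arch t u). f \<subseteq> ?B} = edges (s + 2 * size t + 2) u"
  proof (rule set_eqI)
    fix f
    show "f \<in> {f \<in> edges s (Arch t u). f \<subseteq> ?B} \<longleftrightarrow> f \<in> edges (s + 2 * size t + 2) u"
      unfolding mem_Collect_eq mem using 1[of f] 2[of f] 3 4[of f] by metis
  qed
qed

text \<open>The partner of \<open>s\<close> determines the size of the first subtree and so the
  label ranges of both.\<close>

lemma edges_inj: "edges s t = edges s t' \<Longrightarrow> t = t'"
proof (induction t arbitrary: s t')
  case Empty
  then show ?case by (cases t') auto
next
  case (Arch t u)
  then obtain v w where t': "t' = Arch v w" by (cases t') auto
  have "{s, s + 2 * size t + 1} \<in> edges s (Arch t u)" "{s, s + 2 * size v + 1} \<in> edges s (Arch t u)"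
    using Arch.prems unfolding t' by auto
  from ncm_on_unique[OF ncm_on_edges this, of s] have sz: "size t = size v"
    by (auto simp: doubleton_eq_iff)
  have eq: "edges s (Arch t u) = edges s (Arch v w)" using Arch.prems unfolding t' .
  have "edges (s + 1) t = edges (s + 1) v"
    using edges_inside[of s t u] edges_inside[of s v w] unfolding eq sz by (rule subst)
  moreover have "edges (s + 2 * size t + 2) u = edges (s + 2 * size t + 2) w"
    using edges_after[of s t u] edges_after[of s v w] unfolding eq sz by (rule subst)
  ultimately show ?case using Arch.IH unfolding t' by blast
qed

lemma nc_matchings_eq_edges: "nc_matchings n = edges 1 ` {t. size t = n}"
proof -
  have *: "{1..2*n} = {1..<1 + 2 * n}" by auto
  show ?thesis
  proof (intro set_eqI iffI)
    fix M assume "M \<in> nc_matchings n"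
    then have "ncm_on {1..<1 + 2 * n} M" by (simp only: nc_matchings_iff *)
    from ncm_on_imp_edges[OF this] show "M \<in> edges 1 ` {t. size t = n}" by blast
  next
    fix M assume "M \<in> edges 1 ` {t. size t = n}"
    then obtain t where "size t = n" "M = edges 1 t" by blast
    then show "M \<in> nc_matchings n" using ncm_on_edges[of 1 t] by (simp only: nc_matchings_iff *)
  qed
qed

lemma finite_edges: "finite (edges s t)"
  by (induction t arbitrary: s) auto

lemma sum_edges_Arch:
  "sum g (edges s (Arch t u)) = g {s, s + 2 * size t + 1} + sum g (edges (s + 1) t) + sum g (edges (s + 2 * size t + 2) u)"
proof -
  have "{s, s + 2 * size t + 1} \<notin> edges (s + 1) t \<union> edges (s + 2 * size t + 2) u"
    using edges_range(1)[of "{s, s + 2 * size t + 1}" "s + 1" t]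
      edges_range(1)[of "{s, s + 2 * size t + 1}" "s + 2 * size t + 2" u] by auto
  with edges_disjoint[of s t u] show ?thesis
    by (simp add: finite_edges sum.union_disjoint add.assoc)
qed

section \<open>The weight of a matching\<close>

definition parity_sign :: "nat \<Rightarrow> int" where
  "parity_sign i = (if odd i then 1 else -1)"

lemma parity_sign_simps [simp]:
  "parity_sign (Suc i) = - parity_sign i" "parity_sign (i + 2 * m) = parity_sign i" "parity_sign (i + m * 2) = parity_sign i"
  by (simp_all add: parity_sign_def)

text \<open>For an edge of a matching, the number of edges between its endpoints, computed from its
  labels alone.\<close>

definition inner :: "nat set \<Rightarrow> nat" where
  "inner e = (Max e - Min e - 1) div 2"

lemma inner_pair: "i < j \<Longrightarrow> inner {i, j} = (j - i - 1) div 2"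
  and Min_pair: "i < j \<Longrightarrow> Min {i, j} = (i::nat)"
  by (simp_all add: inner_def)

text \<open>The telescoping: an arch contributes \<open>ev t + od t\<close>, and the edges below it,
  of opposite sign, remove \<open>ev t\<close>.\<close>

lemma sum_inner_edges: "(\<Sum>e\<in>edges s t. parity_sign (Min e) * int (inner e)) = parity_sign s * int (ev t)"
proof (induction t arbitrary: s)
  case (Arch t u)
  have "int (ev t) + int (od t) = int (size t)" using ev_plus_od[of t] by simp
  then have "parity_sign s * int (size t) = parity_sign s * int (ev t) + parity_sign s * int (od t)"
    by (metis distrib_left)
  then show ?case unfolding sum_edges_Arch Arch.IH by (simp add: inner_pair Min_pair algebra_simps)
qed simp

lemma sum_long_edges:
  "(\<Sum>e\<in>edges s t. parity_sign (Min e) * of_bool (h \<le> inner e)) = parity_sign s * long_sign h t"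
proof (induction t arbitrary: s)
  case (Arch t u)
  show ?case unfolding sum_edges_Arch Arch.IH by (simp add: inner_pair Min_pair algebra_simps)
qed simp

lemma sum_sign_edges: "(\<Sum>e\<in>edges s t. parity_sign (Min e)) = parity_sign s * (int (od t) - int (ev t))"
proof (induction t arbitrary: s)
  case (Arch t u)
  show ?case unfolding sum_edges_Arch Arch.IH by (simp add: Min_pair algebra_simps)
qed simp

lemma card_edges: "card (edges s t) = size t"
  using ncm_on_card[OF ncm_on_edges[of s t]] by simp

text \<open>The labels on either side are matched among themselves, so each side holds half as many
  edges as labels.\<close>

lemma edge_length_eq:
  assumes "ncm_on {1..2*n} M" "{i, j} \<in> M" "i < j"
  shows "odd (j - i)" "edge_length n M {i, j} = min ((j - i - 1) div 2) (n - 1 - (j - i - 1) div 2)"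
proof -
  note M = assms(1)
  have ij: "i \<in> {1..2*n}" "j \<in> {1..2*n}" using ncm_on_edgeD[OF assms(1,2)] by auto
  have sub: "{i<..<j} \<subseteq> {1..2*n}" using ij by auto
  have inside: "edges_left n M i j = {f \<in> M. f \<subseteq> {i<..<j}}"
  proof -
    have "f \<noteq> {i, j} \<and> (\<forall>k\<in>f. left_of_ray (circle_pt n i) (circle_pt n j) (circle_pt n k)) \<longleftrightarrow> f \<subseteq> {i<..<j}"
      if "f \<in> M" for f
    proof -
      have "f \<subseteq> {1..2*n}" using ncm_on_edge_subset[OF M that] .
      then have "(\<forall>k\<in>f. left_of_ray (circle_pt n i) (circle_pt n j) (circle_pt n k)) \<longleftrightarrow> f \<subseteq> {i<..<j}"
        using ij assms(3) by (auto simp: left_of_ray_orient orient_pos_iff subset_iff)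
      then show ?thesis by auto
    qed
    then show ?thesis unfolding edges_left_def by blast
  qed
  have outside: "edges_left n M j i = {f \<in> M. f \<subseteq> {1..2*n} - {i..j}}"
  proof -
    have "f \<noteq> {j, i} \<and> (\<forall>k\<in>f. left_of_ray (circle_pt n j) (circle_pt n i) (circle_pt n k)) \<longleftrightarrow> f \<subseteq> {1..2*n} - {i..j}"
      if "f \<in> M" for f
    proof -
      have f: "f \<subseteq> {1..2*n}" using ncm_on_edge_subset[OF M that] .
      have "left_of_ray (circle_pt n j) (circle_pt n i) (circle_pt n k) \<longleftrightarrow> k \<notin> {i..j}" if "k \<in> f" for k
      proof -
        have "k \<in> {1..2*n}" using f that by auto
        from orient_pos_iff[OF ij(2,1) this] show ?thesis using assms(3) by (auto simp: left_of_ray_orient)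
      qed
      then have "(\<forall>k\<in>f. left_of_ray (circle_pt n j) (circle_pt n i) (circle_pt n k)) \<longleftrightarrow> f \<subseteq> {1..2*n} - {i..j}"
        using f by blast
      then show ?thesis using assms(3) by auto
    qed
    then show ?thesis unfolding edges_left_def by blast
  qed
  have c1: "2 * card (edges_left n M i j) = j - i - 1"
    using ncm_on_card[OF ncm_on_inside[OF M assms(2,3) sub]] by (simp add: inside)
  have "card ({1..2*n} - {i..j}) = 2 * n - (j + 1 - i)"
    using ij assms(3) by (subst card_Diff_subset) auto
  then have c2: "2 * card (edges_left n M j i) = 2 * n - (j + 1 - i)"
    using ncm_on_card[OF ncm_on_outside[OF M assms(2,3)]] by (simp add: outside)
  have "j - i = 2 * card (edges_left n M i j) + 1" using c1 assms(3) by simp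
  then show "odd (j - i)" by simp
  have "{card (edges_left n M a b) | a b. {i, j} = {a, b}} = {card (edges_left n M i j), card (edges_left n M j i)}"
    by (auto simp: doubleton_eq_iff)
  then have "edge_length n M {i, j} = min (card (edges_left n M i j)) (card (edges_left n M j i))"
    by (simp add: edge_length_def)
  moreover have "card (edges_left n M i j) = (j - i - 1) div 2" using c1 by simp
  moreover have "card (edges_left n M j i) = n - 1 - (j - i - 1) div 2" using c1 c2 assms(3) ij by auto
  ultimately show "edge_length n M {i, j} = min ((j - i - 1) div 2) (n - 1 - (j - i - 1) div 2)" by simp
qed

lemma edge_sign_eq:
  assumes "i \<in> {1..2*n}" "j \<in> {1..2*n}" "i < j" "j - i \<noteq> n"
  shows "edge_sign n {i, j} = parity_sign (if j - i < n then i else j)"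
proof -
  have n: "n > 0" using assms by auto
  have "start_label n {i, j} = (if j - i < n then i else j)"
    unfolding start_label_def
  proof (rule the_equality)
    show "\<exists>j'. {i, j} = {if j - i < n then i else j, j'} \<and> right_of_ray (circle_pt n (if j - i < n then i else j)) (circle_pt n j') 0"
      using right_of_ray_centre_iff[OF n assms(1-3)] assms(4)
      by (intro exI[of _ "if j - i < n then j else i"]) auto
    show "i' = (if j - i < n then i else j)"
      if "\<exists>j'. {i, j} = {i', j'} \<and> right_of_ray (circle_pt n i') (circle_pt n j') 0" for i'
      using that right_of_ray_centre_iff[OF n assms(1-3)] by (auto simp: doubleton_eq_iff)
  qed
  then show ?thesis by (simp add: edge_sign_def parity_sign_def)
qed

text \<open>If at least \<open>h\<close> edges lie inside, the outer side is the shorter one and the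
  start label is \<open>j\<close>, of opposite parity. The product is then the length
  \<open>n - 1 - m\<close> with reversed sign.\<close>

lemma edge_sign_length:
  assumes "ncm_on {1..2*n} M" "e \<in> M" "n = 2 * h" "h > 0"
  shows "edge_sign n e = parity_sign (Min e) - 2 * (parity_sign (Min e) * of_bool (h \<le> inner e))"
    and "edge_sign n e * int (edge_length n M e)
      = parity_sign (Min e) * int (inner e) - (int n - 1) * (parity_sign (Min e) * of_bool (h \<le> inner e))"
proof -
  obtain i j where ij: "i \<in> {1..2*n}" "j \<in> {1..2*n}" "i < j" "e = {i, j}" using ncm_on_edgeE[OF assms(1,2)] .
  have odd: "odd (j - i)"
    and len: "edge_length n M e = min ((j - i - 1) div 2) (n - 1 - (j - i - 1) div 2)"
    using edge_length_eq[OF assms(1), of i j] assms(2) ij by auto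
  from odd obtain m where m: "j - i = 2 * m + 1" by (rule oddE)
  have j: "j = Suc (i + 2 * m)" using m ij(3) by simp
  have inn: "inner e = m" "Min e = i" using ij(3,4) m by (simp_all add: inner_pair Min_pair)
  have mn: "m \<le> n - 1" using ij(1,2) j by auto
  have len': "edge_length n M e = min m (n - 1 - m)" using len m by simp
  \<comment> \<open>An odd difference cannot equal the even \<open>n\<close>: the edge misses the
    centre.\<close>
  have "j - i \<noteq> n" unfolding m assms(3) by presburger
  from edge_sign_eq[OF ij(1-3) this] have sg: "edge_sign n e = parity_sign (if j - i < n then i else j)"
    by (simp add: ij(4))
  have "j - i < n \<longleftrightarrow> \<not> h \<le> m" unfolding m assms(3) by auto
  then have "edge_sign n e = (if h \<le> m then - parity_sign i else parity_sign i)"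
    unfolding sg j by simp
  moreover have "int (edge_length n M e) = (if h \<le> m then int n - 1 - int m else int m)"
    unfolding len' using mn assms(3,4) by auto
  ultimately show "edge_sign n e = parity_sign (Min e) - 2 * (parity_sign (Min e) * of_bool (h \<le> inner e))"
    "edge_sign n e * int (edge_length n M e)
      = parity_sign (Min e) * int (inner e) - (int n - 1) * (parity_sign (Min e) * of_bool (h \<le> inner e))"
    unfolding inn by (auto simp: algebra_simps)
qed

text \<open>The weight settles \<open>c > 0\<close>; the sum of signs recognises the positive
  perimeter matching for \<open>c = 0\<close>.\<close>

lemma
  assumes "size t = n" "n = 2 * h" "h > 0"
  shows weight_edges: "weight n (edges 1 t) = int (ev t) - (int n - 1) * long_sign h t"
    and sum_edge_sign: "(\<Sum>e\<in>edges 1 t. edge_sign n e) = int (od t) - int (ev t) - 2 * long_sign h t"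
proof -
  have "{1..2*n} = {1..<1 + 2 * size t}" using assms(1) by auto
  then have M: "ncm_on {1..2*n} (edges 1 t)" using ncm_on_edges[of 1 t] by simp
  have one: "parity_sign 1 = 1" by (simp add: parity_sign_def)
  note sl = edge_sign_length[OF M _ assms(2,3)]
  show "weight n (edges 1 t) = int (ev t) - (int n - 1) * long_sign h t"
    unfolding weight_def
    by (simp only: sl(2) sum_subtractf sum_inner_edges sum_long_edges one mult_1_left
        cong: sum.cong flip: sum_distrib_left)
  show "(\<Sum>e\<in>edges 1 t. edge_sign n e) = int (od t) - int (ev t) - 2 * long_sign h t"
    by (simp only: sl(1) sum_subtractf sum_sign_edges sum_long_edges one mult_1_left
        cong: sum.cong flip: sum_distrib_left)
qed

lemma edges_in_W_iff:
  assumes "size t = n" "n = 2 * h" "h > 0" "c \<le> n - 2"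
  shows "edges 1 t \<in> W n (int c) \<longleftrightarrow> ev t = c \<and> long_sign h t = 0"
proof -
  have nc: "edges 1 t \<in> nc_matchings n" using assms(1) nc_matchings_eq_edges by auto
  have range: "long_sign h t = 0 \<or> long_sign h t = 1" using long_sign_range[of t h] assms by auto
  have eo: "int (ev t) + int (od t) = int n" using ev_plus_od[of t] assms(1) by simp
  note wt = weight_edges[OF assms(1-3)] and sg = sum_edge_sign[OF assms(1-3)]
  show ?thesis
  proof (cases "c = 0")
    case False
    have "t \<noteq> Empty" using assms by auto
    then have "od t \<ge> 1" by (cases t) auto
    then have "int (ev t) \<le> int n - 1" using eo by simp
    \<comment> \<open>Since \<open>ev t\<close> is at most \<open>n - 1\<close>, the value 1 of
      \<open>long_sign\<close> would make the weight nonpositive.\<close>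
    then have "weight n (edges 1 t) = int c \<longleftrightarrow> ev t = c \<and> long_sign h t = 0"
      unfolding wt using range False by auto
    then show ?thesis using nc False by (simp add: W_def)
  next
    case True
    \<comment> \<open>Weight 0 alone would not do: the matching of negative perimeter edges has
      \<open>ev t = n - 1\<close> and \<open>long_sign h t = 1\<close>. The sum of signs is
      \<open>n - 2 * (ev t + long_sign h t)\<close>.\<close>
    have le1: "edge_sign n e \<le> 1" for e by (simp add: edge_sign_def)
    have "(\<forall>e\<in>edges 1 t. perimeter_edge n (edges 1 t) e \<and> edge_sign n e = 1) \<longleftrightarrow> ev t = 0 \<and> long_sign h t = 0"
    proof
      assume "\<forall>e\<in>edges 1 t. perimeter_edge n (edges 1 t) e \<and> edge_sign n e = 1"
      then have "(\<Sum>e\<in>edges 1 t. edge_sign n e) = int n" using assms(1) by (simp add: card_edges)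
      then show "ev t = 0 \<and> long_sign h t = 0" using sg eo range by auto
    next
      assume z: "ev t = 0 \<and> long_sign h t = 0"
      \<comment> \<open>Nonnegative defects with sum 0 vanish, so all signs are 1; then the weight
        is the sum of the lengths, which vanish likewise.\<close>
      have "(\<Sum>e\<in>edges 1 t. 1 - edge_sign n e) = 0"
        using sg eo z assms(1) by (simp add: sum_subtractf card_edges)
      then have pos: "\<forall>e\<in>edges 1 t. edge_sign n e = 1"
        using le1 by (subst (asm) sum_nonneg_eq_0_iff) (auto simp: finite_edges)
      have "weight n (edges 1 t) = 0" using wt z by simp
      then have "(\<Sum>e\<in>edges 1 t. int (edge_length n (edges 1 t) e)) = 0"
        using pos by (simp add: weight_def)
      then have "\<forall>e\<in>edges 1 t. edge_length n (edges 1 t) e = 0"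
        by (subst (asm) sum_nonneg_eq_0_iff) (auto simp: finite_edges)
      then show "\<forall>e\<in>edges 1 t. perimeter_edge n (edges 1 t) e \<and> edge_sign n e = 1"
        using pos by (simp add: perimeter_edge_def)
    qed
    then show ?thesis using nc True by (simp add: W_def)
  qed
qed

theorem theorem16:
  fixes n :: nat and c :: int
  assumes "n \<ge> 2" and "even n" and "c \<in> {0..int n - 2}"
  shows "real (card (W n c)) = gen_narayana 1 n (nat \<bar>c\<bar> + 1) / 2"
proof -
  obtain h where h: "n = 2 * h" "h > 0" using assms(1,2) by (auto elim!: evenE)
  obtain k where k: "c = int k" "k \<le> n - 2"
    using assms(1,3) by (intro that[of "nat c"]) auto
  have "W n c = edges 1 ` {t. size t = n \<and> ev t = k \<and> long_sign h t = 0}"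
  proof -
    have "W n c \<subseteq> nc_matchings n" by (auto simp: W_def)
    then show ?thesis unfolding nc_matchings_eq_edges k(1)
      using edges_in_W_iff[OF _ h k(2)] by (auto simp: image_iff subset_iff)
  qed
  then have "card (W n c) = card {t. size t = n \<and> ev t = k \<and> long_sign h t = 0}"
    by (simp add: card_image inj_on_def edges_inj)
  then show ?thesis using card_mtrees_ev_short[OF h(1) _ k(2)] h(2) k(1) by simp
qed

end
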